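(* Let $X$ be a finite dataset, and fix a collection of bins $\mathbb{B}$ of $X$ and a positive integer $MinPts$. Let $\{\epsilon_i\}$ be a family of real numbers, and for each $i$ let DBSCAN with parameters $\epsilon_i$ and $MinPts$ be used to cluster each bin of $\mathbb{B}$, giving the cluster cover $\mathbb{C}_{\epsilon_i}$. If no free-border points exist with respect to $\epsilon_i$ and $MinPts$ (in any bin of $\mathbb{B}$) for all $i$, then there is a filtration of cluster covers $$\{c^{\epsilon_i,\epsilon_j}:\mathbb{C}_{\epsilon_i}\to\mathbb{C}_{\epsilon_j},\ \forall\,\epsilon_i\le\epsilon_j\}.$$
   Context: DBSCAN. Let $Y$ be a finite (ordered) set of points in a metric space, $\epsilon\in\mathbb{R}$, $MinPts$ a positive integer, and $N_\epsilon(p)=\{q\in Y: dist(p,q)\le\epsilon\}$ for $p\in Y$. A point $p\in Y$ is a core point if $|N_\epsilon(p)|\ge MinPts$; a border point if it is not core but lies in $N_\epsilon(p')$ for some core point $p'$; and noise otherwise. A point $q$ is directly density-reachable from $p$ if $p$ is core and $q\in N_\epsilon(p)$. A point $q$ is density-reachable from $p$ if there are points $p=\alpha_1,\dots,\alpha_n=q$ in $Y$, $n\ge 2$, with each $\alpha_{i+1}$ directly density-reachable from $\alpha_i$. Points $p,q$ are density-connected if there is a point $o\in Y$ from which both are density-reachable. DBSCAN outputs a partition $Y=C_1\sqcup\dots\sqcup C_n\sqcup N$, with $N$ the set of noise points and the clusters $C_i$, each containing at least one core point, satisfying: (Maximality) if $p\in C_i$, $q\notin \bigsqcup_{j<i}C_j$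 and $q$ is density-reachable from $p$, then $q\in C_i$; (Connectivity) any $p,q\in C_i$ are density-connected. The assignment of some border points may depend on the ordering of $Y$. A point $s\in Y$ is a free-border point with respect to $\epsilon$ and $MinPts$ if $|N_\epsilon(s)|<MinPts$ and there are core points $p,q\in Y$ with $s\in N_\epsilon(p)$, $s\in N_\epsilon(q)$ and $p$ not density-connected to $q$. Bins and cluster covers. A bin is a subset of $X$; $\mathbb{B}$ is a finite indexed collection of bins covering $X$. DBSCAN is run separately inside each bin (with $Y$ = the bin). The cluster cover is the family of all clusters so obtained, indexed by the bin they come from (clusters in different bins are different elements even if equal as sets); noise points belong to no cluster, and the word "cover" is used regardless. Filtration of cluster covers. A family $\{\mathbb{U}_\lambda\}$ indexed by a partially ordered parameter set is a filtration if it has maps $u^{\lambda,\mu}:\mathbb{U}_\lambda\to\mathbb{U}_\mu$ for $\lambda\le\mu$ such that $u^{\lambda,\mu}(U)=V$ implies $U\subseteq V$, and $u^{\mu,\nu}\circ u^{\lambda,\mu}=u^{\lambda,\nu}$ for $\lambda\le\mu\le\nu$. *)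

theory Defs
  imports "HOL-Analysis.Elementary_Metric_Spaces" "HOL-Library.Disjoint_Sets"
begin

definition eps_nbhd :: "'a::metric_space set \<Rightarrow> real \<Rightarrow> 'a \<Rightarrow> 'a set" where
  "eps_nbhd Y \<epsilon> p = {q \<in> Y. dist p q \<le> \<epsilon>}"

definition core_point :: "'a::metric_space set \<Rightarrow> real \<Rightarrow> nat \<Rightarrow> 'a \<Rightarrow> bool" where
  "core_point Y \<epsilon> MinPts p \<longleftrightarrow> p \<in> Y \<and> card (eps_nbhd Y \<epsilon> p) \<ge> MinPts"

definition border_point :: "'a::metric_space set \<Rightarrow> real \<Rightarrow> nat \<Rightarrow> 'a \<Rightarrow> bool" where
  "border_point Y \<epsilon> MinPts p \<longleftrightarrow>
     p \<in> Y \<and> \<not> core_point Y \<epsilon> MinPts p \<and>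
     (\<exists>p'. core_point Y \<epsilon> MinPts p' \<and> p \<in> eps_nbhd Y \<epsilon> p')"

definition noise_point :: "'a::metric_space set \<Rightarrow> real \<Rightarrow> nat \<Rightarrow> 'a \<Rightarrow> bool" where
  "noise_point Y \<epsilon> MinPts p \<longleftrightarrow>
     p \<in> Y \<and> \<not> core_point Y \<epsilon> MinPts p \<and> \<not> border_point Y \<epsilon> MinPts p"

text \<open>In the following two relations the point named first is the source:
  \<open>density_reachable Y \<epsilon> MinPts p q\<close> says that \<open>q\<close> is density-reachable from \<open>p\<close>.\<close>

definition directly_density_reachable ::
    "'a::metric_space set \<Rightarrow> real \<Rightarrow> nat \<Rightarrow> 'a \<Rightarrow> 'a \<Rightarrow> bool" where
  "directly_density_reachable Y \<epsilon> MinPts p q \<longleftrightarrow>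
     core_point Y \<epsilon> MinPts p \<and> q \<in> eps_nbhd Y \<epsilon> p"

definition density_reachable ::
    "'a::metric_space set \<Rightarrow> real \<Rightarrow> nat \<Rightarrow> 'a \<Rightarrow> 'a \<Rightarrow> bool" where
  "density_reachable Y \<epsilon> MinPts p q \<longleftrightarrow>
     (\<exists>\<alpha>. length \<alpha> \<ge> 2 \<and> set \<alpha> \<subseteq> Y \<and> hd \<alpha> = p \<and> last \<alpha> = q \<and>
          successively (directly_density_reachable Y \<epsilon> MinPts) \<alpha>)"

definition density_connected ::
    "'a::metric_space set \<Rightarrow> real \<Rightarrow> nat \<Rightarrow> 'a \<Rightarrow> 'a \<Rightarrow> bool" where
  "density_connected Y \<epsilon> MinPts p q \<longleftrightarrow>
     (\<exists>o'\<in>Y. density_reachable Y \<epsilon> MinPts o' p \<and> density_reachable Y \<epsilon> MinPts o' q)"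

definition free_border_point :: "'a::metric_space set \<Rightarrow> real \<Rightarrow> nat \<Rightarrow> 'a \<Rightarrow> bool" where
  "free_border_point Y \<epsilon> MinPts s \<longleftrightarrow>
     s \<in> Y \<and> card (eps_nbhd Y \<epsilon> s) < MinPts \<and>
     (\<exists>p q. core_point Y \<epsilon> MinPts p \<and> core_point Y \<epsilon> MinPts q \<and>
            s \<in> eps_nbhd Y \<epsilon> p \<and> s \<in> eps_nbhd Y \<epsilon> q \<and>
            \<not> density_connected Y \<epsilon> MinPts p q)"

text \<open>
  The result of a DBSCAN run is the list of its clusters in the order in which they are
  found; the noise set is not recorded, since it is determined by the input. The result may
  depend on the order in which the points are processed (through the assignment of border
  points), so the possible results are described by a predicate.
\<close>

definition dbscan_output ::
    "'a::metric_space set \<Rightarrow> real \<Rightarrow> nat \<Rightarrow> 'a set list \<Rightarrow> bool" where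
  "dbscan_output Y \<epsilon> MinPts C \<longleftrightarrow>
     Y = (\<Union>i<length C. C ! i) \<union> {p. noise_point Y \<epsilon> MinPts p} \<and>
     disjoint_family_on (\<lambda>i. C ! i) {..<length C} \<and>
     (\<forall>i<length C. C ! i \<inter> {p. noise_point Y \<epsilon> MinPts p} = {}) \<and>
     (\<forall>i<length C. \<exists>p\<in>C ! i. core_point Y \<epsilon> MinPts p) \<and>
     (\<forall>i<length C. \<forall>p q. p \<in> C ! i \<and> q \<notin> (\<Union>j<i. C ! j) \<and>
        density_reachable Y \<epsilon> MinPts p q \<longrightarrow> q \<in> C ! i) \<and>
     (\<forall>i<length C. \<forall>p\<in>C ! i. \<forall>q\<in>C ! i. density_connected Y \<epsilon> MinPts p q)"

text \<open>
  Each cluster is tagged with the index of its bin, so equal sets found in different bins are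
  different elements. Clusters of one run are disjoint and nonempty, so no two of them are
  identified by passing to the set of list entries.
\<close>

definition cluster_cover :: "'b set \<Rightarrow> ('b \<Rightarrow> 'a set list) \<Rightarrow> ('b \<times> 'a set) set" where
  "cluster_cover I C = (SIGMA b:I. set (C b))"

text \<open>
  The elements of a cover are abstract (type \<open>'u\<close>), and \<open>carr\<close> gives the underlying set of an
  element.
\<close>

definition filtration ::
    "'p::order set \<Rightarrow> ('u \<Rightarrow> 'a set) \<Rightarrow> ('p \<Rightarrow> 'u set) \<Rightarrow> ('p \<Rightarrow> 'p \<Rightarrow> 'u \<Rightarrow> 'u) \<Rightarrow> bool" where
  "filtration P carr \<U> u \<longleftrightarrow>
     (\<forall>l\<in>P. \<forall>m\<in>P. l \<le> m \<longrightarrow>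
        u l m \<in> \<U> l \<rightarrow> \<U> m \<and> (\<forall>U\<in>\<U> l. carr U \<subseteq> carr (u l m U))) \<and>
     (\<forall>l\<in>P. \<forall>m\<in>P. \<forall>n\<in>P. l \<le> m \<and> m \<le> n \<longrightarrow>
        (\<forall>U\<in>\<U> l. u m n (u l m U) = u l n U))"

end

theory Submission
  imports Defs
begin

text \<open>
  Raising the radius only adds steps: a core point stays core and its neighbourhood grows, so
  density-reachability is monotone in the radius. It therefore suffices to describe clusters by
  density-reachability alone, and the absence of free-border points is exactly what makes this
  possible: the cluster of a core point \<open>p\<close> is then the set of \<^emph>\<open>all\<close> points reachable from \<open>p\<close>
  (\<open>cluster_eq_reachable\<close>). In general some border points reachable from \<open>p\<close> may already have
  been claimed by a cluster found earlier. A border point claimed by two clusters is, however,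
  adjacent to core points of both, and if it is not free, these core points are
  density-connected; since reachability is symmetric between core points, each cluster would
  then reach the core points of the other (\<open>reachable_of_common_target\<close>), and by maximality the
  earlier one would contain the later one's core points.

  So a cluster at the smaller radius, with core point \<open>p\<close>, is contained in the cluster
  of \<open>p\<close> at the larger radius. The clusters of a run being disjoint and nonempty, the larger
  one is the only cluster of the bin that contains the smaller one
  (\<open>unique_cluster_at_larger_radius\<close>). Among maps that keep the bin, the structure maps are
  thus forced by the containment condition, and so they compose.
\<close>

section \<open>Density-reachability\<close>

text \<open>The transitive closure gives access to rule induction and to splitting off the last
  step of a path.\<close>

lemma density_reachable_eq_tranclp:
  "density_reachable Y \<epsilon> MinPts = (directly_density_reachable Y \<epsilon> MinPts)\<^sup>+\<^sup>+"
    (is "_ = ?D\<^sup>+\<^sup>+")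
proof (intro ext iffI)
  fix p q
  assume "density_reachable Y \<epsilon> MinPts p q"
  then obtain \<alpha> where \<alpha>: "length \<alpha> \<ge> 2" "hd \<alpha> = p" "last \<alpha> = q" "successively ?D \<alpha>"
    by (auto simp: density_reachable_def)
  have "?D\<^sup>+\<^sup>+ (hd xs) (last xs)" if "successively ?D xs" "length xs \<ge> 2" for xs
    using that
  proof (induction xs rule: induct_list012)
    case (3 x y zs)
    then show ?case
      by (cases zs) (auto intro: tranclp_into_tranclp2)
  qed auto
  with \<alpha> show "?D\<^sup>+\<^sup>+ p q" by blast
next
  fix p q
  assume "?D\<^sup>+\<^sup>+ p q"
  then show "density_reachable Y \<epsilon> MinPts p q"
  proof (induction rule: converse_tranclp_induct)
    case (base y)
    then have "y \<in> Y" "q \<in> Y"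
      by (auto simp: directly_density_reachable_def core_point_def eps_nbhd_def)
    with base show ?case
      unfolding density_reachable_def by (intro exI[of _ "[y, q]"]) auto
  next
    case (step y z)
    then obtain \<alpha> where \<alpha>: "length \<alpha> \<ge> 2" "set \<alpha> \<subseteq> Y" "hd \<alpha> = z" "last \<alpha> = q"
        "successively ?D \<alpha>"
      by (auto simp: density_reachable_def)
    have "y \<in> Y"
      using step.hyps(1) by (auto simp: directly_density_reachable_def core_point_def)
    with \<alpha> step.hyps(1) show ?case
      unfolding density_reachable_def
      by (intro exI[of _ "y # \<alpha>"]) (auto simp: successively_Cons)
  qed
qed

lemma density_reachable_trans:
  "density_reachable Y \<epsilon> MinPts p q \<Longrightarrow> density_reachable Y \<epsilon> MinPts q r \<Longrightarrow>
     density_reachable Y \<epsilon> MinPts p r"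
  unfolding density_reachable_eq_tranclp by (rule tranclp_trans)

text \<open>Every point of a path other than its end is core, so a path that also ends in a core
  point can be walked backwards.\<close>

lemma density_reachable_sym:
  assumes "density_reachable Y \<epsilon> MinPts p q" and "core_point Y \<epsilon> MinPts q"
  shows "density_reachable Y \<epsilon> MinPts q p"
proof -
  let ?D = "directly_density_reachable Y \<epsilon> MinPts"
  have D_sym: "?D y x" if "?D x y" "core_point Y \<epsilon> MinPts y" for x y
    using that
    by (auto simp: directly_density_reachable_def eps_nbhd_def core_point_def dist_commute)
  have "?D\<^sup>+\<^sup>+ p q" using assms(1) by (simp add: density_reachable_eq_tranclp)
  then have "?D\<^sup>+\<^sup>+ q p" using assms(2)
  proof (induction rule: tranclp_induct)
    case (base y)
    then show ?case using D_sym by blast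
  next
    case (step y z)
    have "core_point Y \<epsilon> MinPts y"
      using step.hyps(2) by (simp add: directly_density_reachable_def)
    then show ?case
      using step D_sym by (blast intro: tranclp_into_tranclp2)
  qed
  then show ?thesis by (simp add: density_reachable_eq_tranclp)
qed

lemma density_reachable_if_density_connected:
  assumes "density_connected Y \<epsilon> MinPts p q" and "core_point Y \<epsilon> MinPts p"
  shows "density_reachable Y \<epsilon> MinPts p q"
  using assms density_reachable_sym density_reachable_trans
  unfolding density_connected_def by blast

text \<open>For a core point \<open>q\<close> this is symmetry and transitivity. Otherwise the last core points
  on the two paths are neighbours of the border point \<open>q\<close>, and they are density-connected
  because \<open>q\<close> is not free.\<close>

lemma reachable_of_common_target:
  assumes no_free: "\<not> (\<exists>s. free_border_point Y \<epsilon> MinPts s)"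
    and pq: "density_reachable Y \<epsilon> MinPts p q" and rq: "density_reachable Y \<epsilon> MinPts r q"
  shows "density_reachable Y \<epsilon> MinPts r p"
proof (cases "core_point Y \<epsilon> MinPts q")
  case True
  then show ?thesis
    using pq rq density_reachable_sym density_reachable_trans by blast
next
  case False
  let ?D = "directly_density_reachable Y \<epsilon> MinPts"
  have last_step: "\<exists>x'. ?D x' q \<and> (x' = x \<or> density_reachable Y \<epsilon> MinPts x x')"
    if "density_reachable Y \<epsilon> MinPts x q" for x
    using that unfolding density_reachable_eq_tranclp by (auto elim: tranclp.cases)
  obtain p' where p': "?D p' q" "p' = p \<or> density_reachable Y \<epsilon> MinPts p p'"
    using last_step[OF pq] by blast
  obtain r' where r': "?D r' q" "r' = r \<or> density_reachable Y \<epsilon> MinPts r r'"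
    using last_step[OF rq] by blast
  have core: "core_point Y \<epsilon> MinPts p'" "core_point Y \<epsilon> MinPts r'"
    and nbhd: "q \<in> eps_nbhd Y \<epsilon> p'" "q \<in> eps_nbhd Y \<epsilon> r'"
    using p'(1) r'(1) by (simp_all add: directly_density_reachable_def)
  have "q \<in> Y" using nbhd by (simp add: eps_nbhd_def)
  with False have "card (eps_nbhd Y \<epsilon> q) < MinPts" by (simp add: core_point_def)
  with no_free core nbhd \<open>q \<in> Y\<close> have "density_connected Y \<epsilon> MinPts r' p'"
    unfolding free_border_point_def by blast
  then have "density_reachable Y \<epsilon> MinPts r' p'"
    using core(2) by (rule density_reachable_if_density_connected)
  then have "density_reachable Y \<epsilon> MinPts r p'"
    using r'(2) density_reachable_trans by blast
  then show ?thesis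
    using p'(2) core(1) density_reachable_sym density_reachable_trans by blast
qed

lemma core_point_mono:
  assumes "finite Y" and "\<epsilon> \<le> \<epsilon>'" and "core_point Y \<epsilon> MinPts p"
  shows "core_point Y \<epsilon>' MinPts p"
proof -
  have "card (eps_nbhd Y \<epsilon> p) \<le> card (eps_nbhd Y \<epsilon>' p)"
    using assms(1,2) by (intro card_mono) (auto simp: eps_nbhd_def)
  then show ?thesis
    using assms(3) by (auto simp: core_point_def)
qed

lemma density_reachable_mono:
  assumes "finite Y" and "\<epsilon> \<le> \<epsilon>'" and "density_reachable Y \<epsilon> MinPts p q"
  shows "density_reachable Y \<epsilon>' MinPts p q"
proof -
  have step: "directly_density_reachable Y \<epsilon>' MinPts x y"
    if "directly_density_reachable Y \<epsilon> MinPts x y" for x y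
    using that core_point_mono[OF assms(1,2)] assms(2)
    by (auto simp: directly_density_reachable_def eps_nbhd_def)
  show ?thesis
    using assms(3) unfolding density_reachable_eq_tranclp
    by (induction rule: tranclp_induct) (blast intro: step tranclp.intros)+
qed

section \<open>Clusters\<close>

lemma dbscan_clusters_disjoint:
  assumes "dbscan_output Y \<epsilon> MinPts C" and "V \<in> set C" and "W \<in> set C"
    and "p \<in> V" and "p \<in> W"
  shows "V = W"
proof -
  obtain i j where "i < length C" "V = C ! i" "j < length C" "W = C ! j"
    using assms(2,3) by (auto simp: in_set_conv_nth)
  moreover have "disjoint_family_on (\<lambda>i. C ! i) {..<length C}"
    using assms(1) unfolding dbscan_output_def by (elim conjE)
  ultimately show ?thesis
    using assms(4,5) disjoint_family_onD[of "\<lambda>i. C ! i" "{..<length C}" i j] by auto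
qed

lemma dbscan_cluster_has_core_point:
  assumes "dbscan_output Y \<epsilon> MinPts C" and "V \<in> set C"
  obtains p where "p \<in> V" and "core_point Y \<epsilon> MinPts p"
proof -
  obtain i where "i < length C" "V = C ! i"
    using assms(2) by (auto simp: in_set_conv_nth)
  moreover have "\<forall>i<length C. \<exists>p\<in>C ! i. core_point Y \<epsilon> MinPts p"
    using assms(1) unfolding dbscan_output_def by (elim conjE)
  ultimately show ?thesis using that by blast
qed

lemma core_point_in_cluster:
  assumes "dbscan_output Y \<epsilon> MinPts C" and "core_point Y \<epsilon> MinPts p"
  obtains V where "V \<in> set C" and "p \<in> V"
proof -
  have "p \<in> Y" "\<not> noise_point Y \<epsilon> MinPts p"
    using assms(2) by (auto simp: core_point_def noise_point_def)
  moreover have "Y = (\<Union>i<length C. C ! i) \<union> {p. noise_point Y \<epsilon> MinPts p}"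
    using assms(1) unfolding dbscan_output_def by (elim conjE)
  ultimately obtain i where "i < length C" "p \<in> C ! i" by blast
  then show ?thesis using that[of "C ! i"] by simp
qed

lemma dbscan_maximality:
  assumes "dbscan_output Y \<epsilon> MinPts C" and "i < length C" and "p \<in> C ! i"
    and "q \<notin> (\<Union>j<i. C ! j)" and "density_reachable Y \<epsilon> MinPts p q"
  shows "q \<in> C ! i"
proof -
  have "\<forall>i<length C. \<forall>p q. p \<in> C ! i \<and> q \<notin> (\<Union>j<i. C ! j) \<and>
      density_reachable Y \<epsilon> MinPts p q \<longrightarrow> q \<in> C ! i"
    using assms(1) unfolding dbscan_output_def by (elim conjE)
  with assms(2-) show ?thesis by blast
qed

lemma dbscan_connectivity:
  assumes "dbscan_output Y \<epsilon> MinPts C" and "V \<in> set C" and "p \<in> V" and "q \<in> V"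
  shows "density_connected Y \<epsilon> MinPts p q"
proof -
  have "\<forall>i<length C. \<forall>p\<in>C ! i. \<forall>q\<in>C ! i. density_connected Y \<epsilon> MinPts p q"
    using assms(1) unfolding dbscan_output_def by (elim conjE)
  with assms(2-) show ?thesis by (metis in_set_conv_nth)
qed

text \<open>Connectivity gives one inclusion. For the other, a point reachable from \<open>p\<close> can be
  missing from the cluster of \<open>p\<close> only if an earlier cluster took it; but the core points of
  that earlier cluster reach \<open>p\<close>, so maximality would have put \<open>p\<close> there.\<close>

lemma cluster_eq_reachable:
  assumes out: "dbscan_output Y \<epsilon> MinPts C"
    and no_free: "\<not> (\<exists>s. free_border_point Y \<epsilon> MinPts s)"
    and "V \<in> set C" and "p \<in> V" and core: "core_point Y \<epsilon> MinPts p"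
  shows "V = {q. density_reachable Y \<epsilon> MinPts p q}"
proof -
  obtain i where i: "i < length C" "V = C ! i"
    using \<open>V \<in> set C\<close> by (auto simp: in_set_conv_nth)
  have "q \<in> V" if pq: "density_reachable Y \<epsilon> MinPts p q" for q
  proof (rule ccontr)
    assume "q \<notin> V"
    then have "q \<in> (\<Union>j<i. C ! j)"
      using dbscan_maximality[OF out i(1) _ _ pq] i(2) \<open>p \<in> V\<close> by blast
    then obtain j where j: "j < i" "q \<in> C ! j" by blast
    then have "j < length C" using i by simp
    then have "C ! j \<in> set C" by simp
    then obtain r where r: "r \<in> C ! j" "core_point Y \<epsilon> MinPts r"
      by (rule dbscan_cluster_has_core_point[OF out])
    have "density_reachable Y \<epsilon> MinPts r q"
      using dbscan_connectivity[OF out \<open>C ! j \<in> set C\<close> r(1) j(2)] r(2)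
      by (rule density_reachable_if_density_connected)
    then have rp: "density_reachable Y \<epsilon> MinPts r p"
      by (rule reachable_of_common_target[OF no_free pq])
    have "disjoint_family_on (\<lambda>i. C ! i) {..<length C}"
      using out unfolding dbscan_output_def by (elim conjE)
    then have p_notin: "p \<notin> C ! k" if "k < i" for k
      using disjoint_family_onD[of _ _ k i] that i \<open>p \<in> V\<close> by fastforce
    have "p \<notin> (\<Union>k<j. C ! k)"
      using p_notin j(1) by auto
    with out \<open>j < length C\<close> r(1) have "p \<in> C ! j"
      using rp by (rule dbscan_maximality)
    with p_notin j(1) show False by blast
  qed
  moreover have "density_reachable Y \<epsilon> MinPts p q" if "q \<in> V" for q
    using dbscan_connectivity[OF out \<open>V \<in> set C\<close> \<open>p \<in> V\<close> that] core
    by (rule density_reachable_if_density_connected)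
  ultimately show ?thesis by blast
qed

lemma unique_cluster_at_larger_radius:
  assumes "finite Y" and "\<epsilon> \<le> \<epsilon>'"
    and out: "dbscan_output Y \<epsilon> MinPts C" "dbscan_output Y \<epsilon>' MinPts C'"
    and no_free: "\<not> (\<exists>s. free_border_point Y \<epsilon> MinPts s)"
      "\<not> (\<exists>s. free_border_point Y \<epsilon>' MinPts s)"
    and "U \<in> set C"
  shows "\<exists>!V. V \<in> set C' \<and> U \<subseteq> V"
proof -
  obtain p where p: "p \<in> U" "core_point Y \<epsilon> MinPts p"
    using out(1) \<open>U \<in> set C\<close> by (rule dbscan_cluster_has_core_point)
  have p': "core_point Y \<epsilon>' MinPts p"
    using core_point_mono[OF assms(1,2)] p(2) .
  obtain V where V: "V \<in> set C'" "p \<in> V"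
    using out(2) p' by (rule core_point_in_cluster)
  have "U = {q. density_reachable Y \<epsilon> MinPts p q}"
    using cluster_eq_reachable[OF out(1) no_free(1) \<open>U \<in> set C\<close> p] .
  also have "\<dots> \<subseteq> {q. density_reachable Y \<epsilon>' MinPts p q}"
    using density_reachable_mono[OF assms(1,2)] by blast
  also have "\<dots> = V"
    using cluster_eq_reachable[OF out(2) no_free(2) V p'] by simp
  finally have "U \<subseteq> V" .
  with V p(1) dbscan_clusters_disjoint[OF out(2)] show ?thesis by blast
qed

section \<open>The filtration\<close>

theorem theorem4:
  fixes X :: "'a::metric_space set"
    and I :: "'b set" and B :: "'b \<Rightarrow> 'a set"
    and MinPts :: nat
    and J :: "'i set" and eps :: "'i \<Rightarrow> real"
    and C :: "real \<Rightarrow> 'b \<Rightarrow> 'a set list"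
  assumes "finite X"
    and "finite I" and "\<And>b. b \<in> I \<Longrightarrow> B b \<subseteq> X" and "(\<Union>b\<in>I. B b) = X"
    and "MinPts > 0"
    and "\<And>i b. i \<in> J \<Longrightarrow> b \<in> I \<Longrightarrow> dbscan_output (B b) (eps i) MinPts (C (eps i) b)"
    and "\<And>i b. i \<in> J \<Longrightarrow> b \<in> I \<Longrightarrow> \<not> (\<exists>s. free_border_point (B b) (eps i) MinPts s)"
  shows "\<exists>c. filtration (eps ` J) snd (\<lambda>e. cluster_cover I (C e)) c"
proof -
  define target where "target m b U = (THE V. V \<in> set (C m b) \<and> U \<subseteq> V)" for m b U
  have ex1: "\<exists>!V. V \<in> set (C m b) \<and> U \<subseteq> V"
    if "l \<in> eps ` J" "m \<in> eps ` J" "l \<le> m" "b \<in> I" "U \<in> set (C l b)" for l m b U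
  proof -
    have "finite (B b)" using assms(1,3) that(4) finite_subset by blast
    moreover have "dbscan_output (B b) e MinPts (C e b)"
      and "\<not> (\<exists>s. free_border_point (B b) e MinPts s)" if "e \<in> eps ` J" for e
      using that \<open>b \<in> I\<close> assms(6,7) by blast+
    ultimately show ?thesis
      using that by (intro unique_cluster_at_larger_radius[of "B b" l m MinPts "C l b"])
  qed
  have target: "target m b U \<in> set (C m b) \<and> U \<subseteq> target m b U"
    if "l \<in> eps ` J" "m \<in> eps ` J" "l \<le> m" "b \<in> I" "U \<in> set (C l b)" for l m b U
    unfolding target_def using ex1[OF that] by (rule theI')
  \<comment> \<open>Going through the intermediate radius also ends in a cluster that contains \<open>U\<close>.\<close>
  have target_target: "target n b (target m b U) = target n b U"
    if "l \<in> eps ` J" "m \<in> eps ` J" "n \<in> eps ` J" "l \<le> m" "m \<le> n" "b \<in> I" "U \<in> set (C l b)"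
    for l m n b U
  proof -
    note lm = target[of l m b U] and ln = target[of l n b U]
    have "l \<le> n" using that(4,5) by simp
    moreover have "target n b (target m b U) \<in> set (C n b) \<and>
        target m b U \<subseteq> target n b (target m b U)"
      using target[of m n b "target m b U"] lm that by blast
    ultimately show ?thesis
      using lm ln ex1[of l n b U] that by blast
  qed
  have "filtration (eps ` J) snd (\<lambda>e. cluster_cover I (C e)) (\<lambda>_ m (b, U). (b, target m b U))"
    unfolding filtration_def
  proof (intro conjI ballI impI funcsetI)
    fix l m n U
    assume "l \<in> eps ` J" "m \<in> eps ` J" "n \<in> eps ` J" "l \<le> m \<and> m \<le> n"
      "U \<in> cluster_cover I (C l)"
    then show "(case (case U of (b, U) \<Rightarrow> (b, target m b U)) of (b, U) \<Rightarrow> (b, target n b U)) =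
        (case U of (b, U) \<Rightarrow> (b, target n b U))"
      using target_target[of l m n] by (cases U) (simp add: cluster_cover_def)
  next
    fix l m U
    assume lm: "l \<in> eps ` J" "m \<in> eps ` J" "l \<le> m" and U: "U \<in> cluster_cover I (C l)"
    then show "(case U of (b, U) \<Rightarrow> (b, target m b U)) \<in> cluster_cover I (C m)"
      "snd U \<subseteq> snd (case U of (b, U) \<Rightarrow> (b, target m b U))"
      using target[OF lm] by (cases U, simp add: cluster_cover_def)+
  qed
  then show ?thesis by blast
qed

end
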